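(* Let $A\in\mathbb{R}^{d\times d}$ be a global minimizer over $\mathbb{R}^{d\times d}$ of $$L_{REG}(A)=\tfrac12\sum_{s}\mu(s)\sum_{s'}P(s'|s)\big[R(s)+\gamma\phi(s')^TA\mathbf{1}-\phi(s)^TA\mathbf{1}\big]^2+\tfrac12\lambda\sum_{1\le i<j\le d}\Big[e_i^T\Big(\sum_s\mu(s)A^T\phi(s)\phi(s)^TA\Big)e_j\Big]^2 .$$ Then $A^T\Phi^TD\Phi A$ is a diagonal matrix. Furthermore, the global minimum value of $L_{REG}$ over $\mathbb{R}^{d\times d}$ equals the global minimum value over $\theta\in\mathbb{R}^d$ of $$L_{TD}(\theta)=\tfrac12\sum_{s}\mu(s)\sum_{s'}P(s'|s)\big[R(s)+\gamma\phi(s')^T\theta-\phi(s)^T\theta\big]^2 .$$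
   Context: $S=\{s_1,\dots,s_n\}$ is a finite state space. $P(s'|s)$ are the transition probabilities of the Markov chain on $S$ induced by a fixed policy. $\mu:S\to[0,1]$ is a probability distribution on $S$ invariant under $P$, i.e. $\sum_s\mu(s)P(s'|s)=\mu(s')$ for all $s'$. $D=\mathrm{diag}(\mu(s_1),\dots,\mu(s_n))$. $R:S\to\mathbb{R}$ is the reward function, $\gamma\in[0,1)$ the discount factor, $\lambda>0$ the regularization parameter. $\phi:S\to\mathbb{R}^d$ is a given feature map and $\Phi=[\phi(s_1),\dots,\phi(s_n)]^T\in\mathbb{R}^{n\times d}$. $\mathbf{1}\in\mathbb{R}^d$ is the all-ones vector and $e_1,\dots,e_d$ are the standard basis vectors of $\mathbb{R}^d$. *)

theory Defs
  imports "HOL-Analysis.Analysis" "HOL-Probability.Probability_Mass_Function"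
begin

text \<open>
  The states are the elements of a finite type \<open>'s\<close>, and \<open>pmf (P s) s'\<close> is the
  transition probability \<open>P(s'|s)\<close>.  Vectors in \<open>\<real>\<^sup>d\<close> have type \<open>real^'d\<close>; the class
  \<open>linorder\<close> on the index type \<open>'d\<close> is needed only for sums over \<open>i < j\<close>.
\<close>

definition invariant_pmf :: "('s::finite \<Rightarrow> 's pmf) \<Rightarrow> 's pmf \<Rightarrow> bool" where
  "invariant_pmf P \<mu> \<longleftrightarrow> (\<forall>s'. (\<Sum>s\<in>UNIV. pmf \<mu> s * pmf (P s) s') = pmf \<mu> s')"

definition feature_matrix :: "('s::finite \<Rightarrow> real^'d) \<Rightarrow> real^'d^'s" where
  "feature_matrix \<phi> = (\<chi> s. \<phi> s)"

definition diag :: "('n::finite \<Rightarrow> real) \<Rightarrow> real^'n^'n" where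
  "diag f = (\<chi> i j. if i = j then f i else 0)"

definition diagonal_matrix :: "real^'n^'n \<Rightarrow> bool" where
  "diagonal_matrix M \<longleftrightarrow> (\<forall>i j. i \<noteq> j \<longrightarrow> M $ i $ j = 0)"

definition outer :: "real^'d \<Rightarrow> real^'d^'d" where
  "outer v = (columnvector v :: real^1^'d) ** (rowvector v :: real^'d^1)"

definition L_TD ::
  "('s::finite \<Rightarrow> 's pmf) \<Rightarrow> 's pmf \<Rightarrow> ('s \<Rightarrow> real) \<Rightarrow> real \<Rightarrow> ('s \<Rightarrow> real^'d) \<Rightarrow> real^'d \<Rightarrow> real"
where
  "L_TD P \<mu> R \<gamma> \<phi> \<theta> =
     1/2 * (\<Sum>s\<in>UNIV. pmf \<mu> s *
       (\<Sum>s'\<in>UNIV. pmf (P s) s' * (R s + \<gamma> * (\<phi> s' \<bullet> \<theta>) - \<phi> s \<bullet> \<theta>)\<^sup>2))"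

text \<open>In the next definition, the vector \<open>1 :: real^'d\<close> is the all-ones vector.\<close>

definition L_REG ::
  "('s::finite \<Rightarrow> 's pmf) \<Rightarrow> 's pmf \<Rightarrow> ('s \<Rightarrow> real) \<Rightarrow> real \<Rightarrow> real \<Rightarrow>
    ('s \<Rightarrow> real^'d::{finite,linorder}) \<Rightarrow> real^'d::{finite,linorder}^'d::{finite,linorder} \<Rightarrow> real"
where
  "L_REG P \<mu> R \<gamma> lam \<phi> A =
     1/2 * (\<Sum>s\<in>UNIV. pmf \<mu> s *
       (\<Sum>s'\<in>UNIV. pmf (P s) s' * (R s + \<gamma> * (\<phi> s' \<bullet> (A *v 1)) - \<phi> s \<bullet> (A *v 1))\<^sup>2))
     + 1/2 * lam * (\<Sum>(i, j)\<in>{(i, j). i < j}.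
       (axis i 1 \<bullet> ((\<Sum>s\<in>UNIV. pmf \<mu> s *\<^sub>R (transpose A ** outer (\<phi> s) ** A)) *v axis j 1))\<^sup>2)"

end

theory Submission
  imports Defs
begin

text \<open>
  The loss \<open>L_REG A\<close> is \<open>L_TD (A *v 1)\<close> plus a positive multiple of the sum of the squared
  off-diagonal entries of the symmetric matrix in question.  Every \<open>\<theta>\<close> is
  \<open>A *v 1\<close> for a matrix with vanishing penalty, namely the one whose only nonzero column is \<open>\<theta>\<close>.
  Hence the infima coincide, and a minimizer of \<open>L_REG\<close> has vanishing penalty.  The minimum of
  \<open>L_TD\<close> is attained because it is a least-squares problem.
\<close>

text \<open>The range of \<open>f\<close> is a subspace of a finite-dimensional space, hence closed,
  so it contains a point nearest to \<open>- b\<close>.\<close>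

lemma linear_least_squares_attained:
  fixes f :: "'a::euclidean_space \<Rightarrow> 'b::euclidean_space"
  assumes "linear f"
  obtains x where "\<And>y. norm (b + f x) \<le> norm (b + f y)"
proof -
  have "closed (range f)"
    using assms by (intro closed_subspace linear_subspace_image) auto
  then obtain z where z: "z \<in> range f" "\<And>y. y \<in> range f \<Longrightarrow> dist (- b) z \<le> dist (- b) y"
    using distance_attains_inf[of "range f" "- b"] by blast
  then obtain x where x: "z = f x"
    by blast
  have neg: "dist (- b) u = norm (b + u)" for u
    by (simp add: dist_norm norm_minus_commute add.commute)
  show ?thesis
    using z(2) by (intro that[of x]) (auto simp: x neg)
qed

text \<open>Scaling coordinate \<open>i\<close> by \<open>sqrt (w i)\<close> turns the weighted sum
  of squares into the squared Euclidean norm of an affine map.\<close>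

lemma weighted_least_squares_attained:
  fixes c :: "'i::finite \<Rightarrow> 'a::euclidean_space" and w b :: "'i \<Rightarrow> real"
  assumes "\<And>i. 0 \<le> w i"
  obtains x where
    "\<And>y. (\<Sum>i\<in>UNIV. w i * (b i + c i \<bullet> x)\<^sup>2) \<le> (\<Sum>i\<in>UNIV. w i * (b i + c i \<bullet> y)\<^sup>2)"
proof -
  define f where "f = (\<lambda>x. \<chi> i. sqrt (w i) * (c i \<bullet> x))"
  define b' where "b' = (\<chi> i. sqrt (w i) * b i)"
  have "linear f"
    by (rule linearI) (simp_all add: f_def vec_eq_iff algebra_simps)
  from linear_least_squares_attained[OF this, of b']
  obtain x where x: "\<And>y. norm (b' + f x) \<le> norm (b' + f y)"
    by metis
  have norm_sq: "(norm (b' + f y))\<^sup>2 = (\<Sum>i\<in>UNIV. w i * (b i + c i \<bullet> y)\<^sup>2)" for y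
    using assms
    by (simp add: norm_vec_def L2_set_def sum_nonneg b'_def f_def
        distrib_left[symmetric] power_mult_distrib)
  show ?thesis
    using x by (intro that[of x]) (simp add: norm_sq[symmetric])
qed

text \<open>The nested expectation is one sum over pairs of states, weighted by the joint
  probability of a state and its successor; each residual is affine in
  \<open>\<theta>\<close>.\<close>

lemma L_TD_attains_min:
  obtains \<theta> where "\<And>\<theta>'. L_TD P \<mu> R \<gamma> \<phi> \<theta> \<le> L_TD P \<mu> R \<gamma> \<phi> \<theta>'"
proof -
  define w where "w = (\<lambda>(s, s'). pmf \<mu> s * pmf (P s) s')"
  define c where "c = (\<lambda>(s, s'). \<gamma> *\<^sub>R \<phi> s' - \<phi> s)"
  have L: "L_TD P \<mu> R \<gamma> \<phi> \<theta> = 1/2 * (\<Sum>p\<in>UNIV. w p * (R (fst p) + c p \<bullet> \<theta>)\<^sup>2)" for \<theta>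
    unfolding L_TD_def sum_distrib_left sum.cartesian_product UNIV_Times_UNIV
    by (intro sum.cong) (auto simp: w_def c_def algebra_simps)
  show ?thesis
  proof (rule weighted_least_squares_attained[of w "\<lambda>p. R (fst p)" c])
    show "0 \<le> w p" for p
      by (simp add: w_def case_prod_beta)
  next
    fix \<theta>
    assume "(\<Sum>p\<in>UNIV. w p * (R (fst p) + c p \<bullet> \<theta>)\<^sup>2)
      \<le> (\<Sum>p\<in>UNIV. w p * (R (fst p) + c p \<bullet> \<theta>')\<^sup>2)" for \<theta>'
    then have "L_TD P \<mu> R \<gamma> \<phi> \<theta> \<le> L_TD P \<mu> R \<gamma> \<phi> \<theta>'" for \<theta>'
      unfolding L by (intro mult_left_mono) auto
    then show ?thesis
      by (rule that)
  qed
qed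

text \<open>With u the product of the transpose of \<open>A\<close> and \<open>v\<close>, the
  conjugated matrix is the outer product of u with itself, and coordinate \<open>i\<close> of u is
  \<open>v \<bullet> column i A\<close>.\<close>

lemma outer_conj_entry:
  "(transpose A ** outer v ** A) $ i $ j = (v \<bullet> column i A) * (v \<bullet> column j A)"
proof -
  have "(transpose A ** outer v ** A) $ i $ j
      = (\<Sum>k\<in>UNIV. (\<Sum>l\<in>UNIV. A $ l $ i * (v $ l * v $ k)) * A $ k $ j)"
    by (simp add: matrix_matrix_mult_def transpose_def outer_def columnvector_def rowvector_def)
  also have "\<dots> = (\<Sum>l\<in>UNIV. v $ l * A $ l $ i) * (\<Sum>k\<in>UNIV. v $ k * A $ k $ j)"
    unfolding sum_product sum_distrib_right
    by (subst sum.swap) (simp add: mult_ac sum_distrib_left)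
  finally show ?thesis
    by (simp add: inner_vec_def column_def)
qed

text \<open>Gram matrix of the columns of \<open>feature_matrix \<phi> ** A\<close> for the bilinear
  form with weights \<open>w\<close>. It links the penalty to the matrix in the theorem: both have
  these entries.\<close>

definition weighted_gram :: "('s::finite \<Rightarrow> real) \<Rightarrow> ('s \<Rightarrow> real^'d) \<Rightarrow> real^'n^'d \<Rightarrow> 'n \<Rightarrow> 'n \<Rightarrow> real"
  where "weighted_gram w \<phi> A i j = (\<Sum>s\<in>UNIV. w s * ((\<phi> s \<bullet> column i A) * (\<phi> s \<bullet> column j A)))"

lemma weighted_gram_commute: "weighted_gram w \<phi> A i j = weighted_gram w \<phi> A j i"
  by (simp add: weighted_gram_def mult.commute mult.left_commute)

lemma transpose_mult_entry: "(transpose M ** N) $ i $ j = (\<Sum>k\<in>UNIV. M $ k $ i * N $ k $ j)"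
  by (simp add: matrix_matrix_mult_def transpose_def)

lemma diag_mult_entry: "(diag w ** N) $ i $ j = w i * N $ i $ j"
  by (simp add: matrix_matrix_mult_def diag_def if_distrib[of "\<lambda>x. x * _"] cong: if_cong)

lemma feature_matrix_conj_entry:
  "(transpose A ** transpose (feature_matrix \<phi>) ** diag w ** feature_matrix \<phi> ** A) $ i $ j
    = weighted_gram w \<phi> A i j"
proof -
  have FA: "(feature_matrix \<phi> ** A) $ s $ k = \<phi> s \<bullet> column k A" for s k
    by (simp add: matrix_matrix_mult_def feature_matrix_def inner_vec_def column_def)
  \<comment> \<open>Regrouping around \<open>feature_matrix \<phi> ** A\<close> exposes the Gram
    form.\<close>
  have "transpose A ** transpose (feature_matrix \<phi>) ** diag w ** feature_matrix \<phi> ** A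
      = transpose (feature_matrix \<phi> ** A) ** (diag w ** (feature_matrix \<phi> ** A))"
    by (simp add: matrix_transpose_mul matrix_mul_assoc)
  then show ?thesis
    by (simp add: transpose_mult_entry diag_mult_entry FA weighted_gram_def mult_ac)
qed

lemma L_REG_eq:
  "L_REG P \<mu> R \<gamma> lam \<phi> A = L_TD P \<mu> R \<gamma> \<phi> (A *v 1)
    + 1/2 * lam * (\<Sum>(i, j)\<in>{(i, j). i < j}. (weighted_gram (pmf \<mu>) \<phi> A i j)\<^sup>2)"
proof -
  \<comment> \<open>Pairing with two basis vectors extracts the matrix entry at \<open>i\<close>,
    \<open>j\<close>.\<close>
  have "axis i 1 \<bullet> ((\<Sum>s\<in>UNIV. pmf \<mu> s *\<^sub>R (transpose A ** outer (\<phi> s) ** A)) *v axis j 1)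
      = weighted_gram (pmf \<mu>) \<phi> A i j" for i j
    by (simp add: inner_axis' matrix_vector_mul_component inner_axis outer_conj_entry
        weighted_gram_def)
  then show ?thesis
    by (simp add: L_REG_def L_TD_def)
qed

lemma L_REG_ge_L_TD:
  assumes "0 \<le> lam"
  shows "L_TD P \<mu> R \<gamma> \<phi> (A *v 1) \<le> L_REG P \<mu> R \<gamma> lam \<phi> A"
  using assms by (simp add: L_REG_eq sum_nonneg case_prod_beta)

lemma L_REG_realizes_L_TD:
  fixes \<theta> :: "real^'d::{finite,linorder}"
  obtains A where "L_REG P \<mu> R \<gamma> lam \<phi> A = L_TD P \<mu> R \<gamma> \<phi> \<theta>"
proof -
  \<comment> \<open>Any column can carry \<open>\<theta>\<close>; \<open>undefined\<close> merely
    names some index.\<close>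
  define k :: 'd where "k = undefined"
  define A where "A = (\<chi> i j. if j = k then \<theta> $ i else 0)"
  have "A *v 1 = \<theta>"
    by (simp add: A_def matrix_vector_mult_def vec_eq_iff)
  moreover have "column j A = 0" if "j \<noteq> k" for j
    using that by (simp add: A_def column_def vec_eq_iff)
  \<comment> \<open>Distinct indices cannot both be \<open>k\<close>, so one factor in every summand
    involves a zero column.\<close>
  then have "weighted_gram (pmf \<mu>) \<phi> A i j = 0" if "i < j" for i j
    using that by (cases "i = k"; cases "j = k") (auto simp: weighted_gram_def)
  then have "(\<Sum>(i, j)\<in>{(i, j). i < j}. (weighted_gram (pmf \<mu>) \<phi> A i j)\<^sup>2) = 0"
    by (intro sum.neutral) auto
  ultimately show ?thesis
    by (intro that[of A]) (simp add: L_REG_eq)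
qed

text \<open>Vanishing squares settle the entries above the diagonal; symmetry of the Gram matrix
  settles those below.\<close>

lemma penalty_zero_imp_diagonal_matrix:
  fixes A :: "real^('n::{finite,linorder})^('d::finite)"
  assumes "(\<Sum>(i, j)\<in>{(i, j). i < j}. (weighted_gram w \<phi> A i j)\<^sup>2) = 0"
  shows "diagonal_matrix
    (transpose A ** transpose (feature_matrix \<phi>) ** diag w ** feature_matrix \<phi> ** A)"
proof -
  have "weighted_gram w \<phi> A i j = 0" if "i < j" for i j
    using assms that by (subst (asm) sum_nonneg_eq_0_iff) auto
  then have "weighted_gram w \<phi> A i j = 0" if "i \<noteq> j" for i j
    using that weighted_gram_commute[of w \<phi> A i j] by (cases i j rule: linorder_cases) auto
  then show ?thesis
    by (simp add: diagonal_matrix_def feature_matrix_conj_entry)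
qed

theorem proposition1:
  fixes P :: "'s::finite \<Rightarrow> 's pmf"
    and \<mu> :: "'s pmf"
    and R :: "'s \<Rightarrow> real"
    and \<gamma> lam :: real
    and \<phi> :: "'s \<Rightarrow> real^'d::{finite,linorder}"
  assumes "invariant_pmf P \<mu>"
    and "0 \<le> \<gamma>" and "\<gamma> < 1"
    and "0 < lam"
  shows "(\<forall>A. is_arg_min (L_REG P \<mu> R \<gamma> lam \<phi>) (\<lambda>_. True) A \<longrightarrow>
            diagonal_matrix
              (transpose A ** transpose (feature_matrix \<phi>) ** diag (pmf \<mu>) ** feature_matrix \<phi> ** A))
       \<and> (\<exists>A \<theta>. is_arg_min (L_REG P \<mu> R \<gamma> lam \<phi>) (\<lambda>_. True) A
              \<and> is_arg_min (L_TD P \<mu> R \<gamma> \<phi>) (\<lambda>_. True) \<theta>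
              \<and> L_REG P \<mu> R \<gamma> lam \<phi> A = L_TD P \<mu> R \<gamma> \<phi> \<theta>)"
proof (intro conjI allI impI)
  fix A
  assume min: "is_arg_min (L_REG P \<mu> R \<gamma> lam \<phi>) (\<lambda>_. True) A"
  \<comment> \<open>The competitor \<open>B\<close> attains the TD loss of \<open>A\<close> without
    penalty, so minimality of \<open>A\<close> leaves no room for a positive penalty.\<close>
  obtain B where "L_REG P \<mu> R \<gamma> lam \<phi> B = L_TD P \<mu> R \<gamma> \<phi> (A *v 1)"
    by (rule L_REG_realizes_L_TD)
  with min have "L_REG P \<mu> R \<gamma> lam \<phi> A \<le> L_TD P \<mu> R \<gamma> \<phi> (A *v 1)"
    unfolding is_arg_min_linorder by metis
  then have "(\<Sum>(i, j)\<in>{(i, j). i < j}. (weighted_gram (pmf \<mu>) \<phi> A i j)\<^sup>2) \<le> 0"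
    using \<open>0 < lam\<close> by (simp add: L_REG_eq mult_le_0_iff)
  moreover have "0 \<le> (\<Sum>(i, j)\<in>{(i, j). i < j}. (weighted_gram (pmf \<mu>) \<phi> A i j)\<^sup>2)"
    by (simp add: sum_nonneg case_prod_beta)
  ultimately show "diagonal_matrix
      (transpose A ** transpose (feature_matrix \<phi>) ** diag (pmf \<mu>) ** feature_matrix \<phi> ** A)"
    by (intro penalty_zero_imp_diagonal_matrix) linarith
next
  obtain \<theta> where \<theta>: "\<And>\<theta>'. L_TD P \<mu> R \<gamma> \<phi> \<theta> \<le> L_TD P \<mu> R \<gamma> \<phi> \<theta>'"
    using L_TD_attains_min by blast
  obtain A where A: "L_REG P \<mu> R \<gamma> lam \<phi> A = L_TD P \<mu> R \<gamma> \<phi> \<theta>"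
    by (rule L_REG_realizes_L_TD)
  \<comment> \<open>The value at \<open>A\<close> is the least TD loss, which is at most the TD loss
    at \<open>B *v 1\<close> and hence at most \<open>L_REG\<close> at \<open>B\<close>.\<close>
  have "L_REG P \<mu> R \<gamma> lam \<phi> A \<le> L_REG P \<mu> R \<gamma> lam \<phi> B" for B
    using A \<theta>[of "B *v 1"] L_REG_ge_L_TD[of lam P \<mu> R \<gamma> \<phi> B] \<open>0 < lam\<close> by linarith
  with A \<theta> show "\<exists>A \<theta>. is_arg_min (L_REG P \<mu> R \<gamma> lam \<phi>) (\<lambda>_. True) A
      \<and> is_arg_min (L_TD P \<mu> R \<gamma> \<phi>) (\<lambda>_. True) \<theta>
      \<and> L_REG P \<mu> R \<gamma> lam \<phi> A = L_TD P \<mu> R \<gamma> \<phi> \<theta>"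
    unfolding is_arg_min_linorder by blast
qed

end
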